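(* Let $T\in\mathbb{N}$, let $A_{cl,0},\dots,A_{cl,T-1}\in\mathbb{R}^{n_x\times n_x}$ be given matrices, let $\hat{\mathbb{P}}$ be the empirical disturbance distribution and $\epsilon>0$. Let $\hat Q_{N,i}$ denote the distribution of $\hat e_i$, where $\hat e_0=0$, $\hat e_{i+1}=A_{cl,i}\hat e_i+\hat W_i$ and $\hat W_i$ are i.i.d. with law $\hat{\mathbb{P}}$. Let $\mathbb{T}_\epsilon(\hat{\mathbb{P}})$ (the Wasserstein ambiguity tube) be the set of all sequences of distributions $\{Q_i\}_{i=0,\dots,T}$ for which there is a probability distribution $\mathbb{P}_w$ with $d_w(\mathbb{P}_w,\hat{\mathbb{P}})\le\epsilon$ such that $Q_i$ is the law of $e_i$, where $e_0=0$, $e_{i+1}=A_{cl,i}e_i+W_i$ and $W_i$ are i.i.d. with law $\mathbb{P}_w$. Then for every $\{Q_i\}\in\mathbb{T}_\epsilon(\hat{\mathbb{P}})$ and every $i=0,\dots,T$, $$ d_w\big(Q_i,\hat Q_{N,i}\big)\le \epsilon\cdot\sum_{m=0}^{i-1}\ \prod_{j=0}^{i-1-m}\Big\|A_{cl,i-1-j}^{\min\{1,\,i-1-m-j\}}\Big\|, $$ where $\|\cdot\|$ on matrices is the induced matrix norm corresponding to the vector norm used in $d_w$.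
   Context: $\mathbb{W}_w=\{w\in\mathbb{R}^{n_x}\mid H_ww\le h_w\}$ is the polyhedral disturbance support. The empirical distribution is $\hat{\mathbb{P}}=\frac1M\sum_{l=1}^M\delta_{\hat w^{(l)}}$ for samples $\hat w^{(1)},\dots,\hat w^{(M)}\in\mathbb{W}_w$, and $\mathbb{P}_w$ ranges over probability distributions supported on $\mathbb{W}_w$ with finite first moment. For a fixed norm $\|\cdot\|$ on $\mathbb{R}^{n_x}$, the type-1 Wasserstein metric between probability distributions with finite first moment is $d_w(\mathbb{Q}_1,\mathbb{Q}_2)=\inf_\Pi\int\|\xi_1-\xi_2\|\,\Pi(d\xi_1,d\xi_2)$, the infimum being over joint distributions $\Pi$ with marginals $\mathbb{Q}_1$ and $\mathbb{Q}_2$. Matrix powers with exponent $0$ equal the identity, so that $\prod_{j=0}^{i-1-m}A_{cl,i-1-j}^{\min\{1,i-1-m-j\}}=A_{cl,i-1}A_{cl,i-2}\cdots A_{cl,m+1}$ (identity if $m=i-1$). An empty sum (case $i=0$) is $0$. *)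

theory Defs
  imports "HOL-Probability.Probability"
begin

text \<open>The library function \<^const>\<open>norm\<close> on \<^typ>\<open>real ^ 'n\<close> is the Euclidean norm; an arbitrary norm
  is therefore carried as an explicit function.\<close>

definition is_norm :: "(real ^ 'n \<Rightarrow> real) \<Rightarrow> bool" where
  "is_norm N \<longleftrightarrow>
     (\<forall>x. 0 \<le> N x) \<and> (\<forall>x. N x = 0 \<longleftrightarrow> x = 0) \<and>
     (\<forall>c x. N (c *\<^sub>R x) = \<bar>c\<bar> * N x) \<and> (\<forall>x y. N (x + y) \<le> N x + N y)"

definition induced_norm :: "(real ^ 'n \<Rightarrow> real) \<Rightarrow> real ^ 'n ^ 'n \<Rightarrow> real" where
  "induced_norm N A = (SUP x\<in>{x. x \<noteq> 0}. N (A *v x) / N x)"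

text \<open>The library power \<open>A ^ k\<close> on \<^typ>\<open>real ^ 'n ^ 'n\<close> is componentwise, hence not the matrix power.\<close>

definition matpow :: "real ^ 'n ^ 'n \<Rightarrow> nat \<Rightarrow> real ^ 'n ^ 'n" where
  "matpow A k = (((**) A) ^^ k) (mat 1)"

definition prob_distribution :: "(real ^ 'n) measure \<Rightarrow> bool" where
  "prob_distribution P \<longleftrightarrow> prob_space P \<and> sets P = sets borel"

definition finite_first_moment :: "(real ^ 'n \<Rightarrow> real) \<Rightarrow> (real ^ 'n) measure \<Rightarrow> bool" where
  "finite_first_moment N P \<longleftrightarrow> integrable P N"

definition couplings ::
  "(real ^ 'n) measure \<Rightarrow> (real ^ 'n) measure \<Rightarrow> ((real ^ 'n) \<times> (real ^ 'n)) measure set" where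
  "couplings Q1 Q2 =
     {\<gamma>. prob_space \<gamma> \<and> sets \<gamma> = sets (borel \<Otimes>\<^sub>M borel) \<and>
         distr \<gamma> borel fst = Q1 \<and> distr \<gamma> borel snd = Q2}"

text \<open>Valued in \<^typ>\<open>ennreal\<close>, so that no spurious value arises from a non-integrable cost; it is
  finite whenever both arguments have finite first moment.\<close>

definition wasserstein1 ::
  "(real ^ 'n \<Rightarrow> real) \<Rightarrow> (real ^ 'n) measure \<Rightarrow> (real ^ 'n) measure \<Rightarrow> ennreal" where
  "wasserstein1 N Q1 Q2 =
     (INF \<gamma>\<in>couplings Q1 Q2. \<integral>\<^sup>+ (\<xi>1, \<xi>2). ennreal (N (\<xi>1 - \<xi>2)) \<partial>\<gamma>)"

definition disturbance_support :: "real ^ 'n ^ 'm \<Rightarrow> real ^ 'm \<Rightarrow> (real ^ 'n) set" where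
  "disturbance_support H h = {w. \<forall>k. (H *v w) $ k \<le> h $ k}"

definition empirical :: "nat \<Rightarrow> (nat \<Rightarrow> real ^ 'n) \<Rightarrow> (real ^ 'n) measure" where
  "empirical M wh =
     measure_of UNIV (sets borel) (\<lambda>B. (\<Sum>l = 1..M. emeasure (return borel (wh l)) B) / of_nat M)"

primrec err :: "(nat \<Rightarrow> real ^ 'n ^ 'n) \<Rightarrow> (nat \<Rightarrow> real ^ 'n) \<Rightarrow> nat \<Rightarrow> real ^ 'n" where
  "err A w 0 = 0"
| "err A w (Suc i) = A i *v err A w i + w i"

definition iid_with_law ::
  "'b measure \<Rightarrow> (nat \<Rightarrow> 'b \<Rightarrow> real ^ 'n) \<Rightarrow> nat set \<Rightarrow> (real ^ 'n) measure \<Rightarrow> bool" where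
  "iid_with_law \<Omega> W I P \<longleftrightarrow>
     prob_space \<Omega> \<and> prob_space.indep_vars \<Omega> (\<lambda>_. borel) W I \<and> (\<forall>t\<in>I. distr \<Omega> borel (W t) = P)"

definition err_law ::
  "'b measure \<Rightarrow> (nat \<Rightarrow> real ^ 'n ^ 'n) \<Rightarrow> (nat \<Rightarrow> 'b \<Rightarrow> real ^ 'n) \<Rightarrow> nat \<Rightarrow> (real ^ 'n) measure" where
  "err_law \<Omega> A W i = distr \<Omega> borel (\<lambda>\<omega>. err A (\<lambda>t. W t \<omega>) i)"

text \<open>The probability space carrying the noise is quantified over the type \<^typ>\<open>nat \<Rightarrow> real ^ 'n\<close> of
  noise paths only; \<open>ambiguity_tubeI\<close> below shows that this loses no generality.\<close>

definition ambiguity_tube ::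
  "(real ^ 'n \<Rightarrow> real) \<Rightarrow> (real ^ 'n) set \<Rightarrow> nat \<Rightarrow> (nat \<Rightarrow> real ^ 'n ^ 'n) \<Rightarrow> (real ^ 'n) measure \<Rightarrow>
     real \<Rightarrow> (nat \<Rightarrow> (real ^ 'n) measure) set" where
  "ambiguity_tube N S T A Phat \<epsilon> =
     {Q. \<exists>P. prob_distribution P \<and> (AE w in P. w \<in> S) \<and> finite_first_moment N P \<and>
             wasserstein1 N P Phat \<le> ennreal \<epsilon> \<and>
             (\<exists>(\<Omega> :: (nat \<Rightarrow> real ^ 'n) measure) W. iid_with_law \<Omega> W {..<T} P \<and>
                (\<forall>i\<le>T. Q i = err_law \<Omega> A W i))}"

lemma sets_empirical [simp]: "sets (empirical M (wh :: nat \<Rightarrow> real ^ 'a)) = sets borel"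
  using sets.sets_measure_of_eq[of "borel :: (real ^ 'a) measure"] by (simp add: empirical_def)

lemma emeasure_empirical:
  assumes B: "B \<in> sets borel"
  shows "emeasure (empirical M wh) B = (\<Sum>l = 1..M. emeasure (return borel (wh l)) B) / of_nat M"
proof (rule emeasure_measure_of[OF empirical_def])
  let ?f = "\<lambda>B. (\<Sum>l = 1..M. emeasure (return borel (wh l)) B) / of_nat M :: ennreal"
  show "sets borel \<subseteq> Pow (UNIV :: (real ^ 'a) set)" by simp
  show "positive (sets (empirical M wh)) ?f" by (simp add: positive_def)
  show "countably_additive (sets (empirical M wh)) ?f"
  proof (rule countably_additiveI)
    fix C :: "nat \<Rightarrow> (real ^ 'a) set"
    assume C: "range C \<subseteq> sets (empirical M wh)" "disjoint_family C"
    have "(\<Sum>n. ?f (C n)) = (\<Sum>n. \<Sum>l = 1..M. emeasure (return borel (wh l)) (C n)) / of_nat M"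
      by (simp add: divide_ennreal_def)
    also have "(\<Sum>n. \<Sum>l = 1..M. emeasure (return borel (wh l)) (C n)) =
        (\<Sum>l = 1..M. \<Sum>n. emeasure (return borel (wh l)) (C n))"
      by (rule suminf_sum) simp
    also have "\<dots> = (\<Sum>l = 1..M. emeasure (return borel (wh l)) (\<Union>n. C n))"
      using C by (intro sum.cong refl suminf_emeasure) auto
    finally show "(\<Sum>n. ?f (C n)) = ?f (\<Union>n. C n)" .
  qed
  show "B \<in> sets (empirical M wh)" using B by simp
qed

lemma prob_distribution_empirical:
  assumes "1 \<le> M"
  shows "prob_distribution (empirical M wh)"
proof -
  have sp: "space (empirical M wh) = UNIV"
    using sets_eq_imp_space_eq[OF sets_empirical] by simp
  have "emeasure (empirical M wh) UNIV = of_nat M / of_nat M"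
    by (subst emeasure_empirical) auto
  also have "\<dots> = 1"
    using assms by (intro ennreal_divide_self) (auto simp: of_nat_less_top)
  finally show ?thesis
    by (auto simp: prob_distribution_def sp intro!: prob_spaceI)
qed

lemma err_cong: "(\<And>t. t < i \<Longrightarrow> w t = w' t) \<Longrightarrow> err A w i = err A w' i"
  by (induction i) auto

lemma borel_measurable_err:
  assumes "\<And>t. t < i \<Longrightarrow> W t \<in> borel_measurable \<Omega>"
  shows "(\<lambda>\<omega>. err A (\<lambda>t. W t \<omega>) i) \<in> borel_measurable \<Omega>"
  using assms
proof (induction i)
  case (Suc i)
  have "(\<lambda>x. A i *v x) \<in> borel_measurable borel"
    by (intro borel_measurable_continuous_onI linear_continuous_on)
       (simp add: linear_conv_bounded_linear[symmetric])
  from measurable_compose[OF _ this] Suc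
  have "(\<lambda>\<omega>. A i *v err A (\<lambda>t. W t \<omega>) i) \<in> borel_measurable \<Omega>" by simp
  moreover have "W i \<in> borel_measurable \<Omega>" using Suc.prems by simp
  ultimately show ?case by (simp only: err.simps borel_measurable_add)
qed simp

lemma ambiguity_tubeI:
  fixes \<Omega> :: "'b measure" and W :: "nat \<Rightarrow> 'b \<Rightarrow> real ^ 'n"
  assumes P: "prob_distribution P" "AE w in P. w \<in> S" "finite_first_moment N P"
      "wasserstein1 N P Phat \<le> ennreal \<epsilon>"
    and iid: "iid_with_law \<Omega> W {..<T} P"
    and Q: "\<And>i. i \<le> T \<Longrightarrow> Q i = err_law \<Omega> A W i"
  shows "Q \<in> ambiguity_tube N S T A Phat \<epsilon>"
proof -
  interpret prob_space \<Omega> using iid by (simp add: iid_with_law_def)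
  have ind: "indep_vars (\<lambda>_. borel) W {..<T}" and law: "\<And>t. t < T \<Longrightarrow> distr \<Omega> borel (W t) = P"
    using iid by (auto simp: iid_with_law_def)
  have meas: "\<And>t. t < T \<Longrightarrow> W t \<in> borel_measurable \<Omega>"
    using ind by (auto simp: indep_vars_def)
  define B :: "(nat \<Rightarrow> real ^ 'n) measure" where "B = (\<Pi>\<^sub>M t\<in>{..<T}. borel)"
  define R where "R = (\<lambda>\<omega>. \<lambda>t\<in>{..<T}. W t \<omega>)"
  define D where "D = distr \<Omega> B R"
  define X :: "nat \<Rightarrow> (nat \<Rightarrow> real ^ 'n) \<Rightarrow> real ^ 'n" where "X = (\<lambda>t \<omega>. \<omega> t)"
  have R: "R \<in> measurable \<Omega> B"
    unfolding R_def B_def using meas by (intro measurable_restrict) auto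
  have sD: "sets D = sets B" by (simp add: D_def)
  have X: "X t \<in> measurable B borel" if "t < T" for t
    unfolding X_def B_def using that by (intro measurable_component_singleton) simp
  interpret D: prob_space D unfolding D_def by (rule prob_space_distr[OF R])
  have lawD: "distr D borel (X t) = P" if "t < T" for t
  proof -
    have "distr D borel (X t) = distr \<Omega> borel (X t \<circ> R)"
      unfolding D_def by (rule distr_distr[OF X[OF that] R])
    also have "X t \<circ> R = W t" using that by (auto simp: X_def R_def)
    finally show ?thesis using law[OF that] by simp
  qed
  have indD: "D.indep_vars (\<lambda>_. borel) X {..<T}"
  proof (cases "T = 0")
    case True
    then show ?thesis by (simp add: D.indep_vars_def D.indep_sets_def)
  next
    case False
    have XD: "\<And>t. t < T \<Longrightarrow> X t \<in> measurable D borel"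
      using X by (simp add: D_def)
    have "distr D B (\<lambda>\<omega>. \<lambda>t\<in>{..<T}. X t \<omega>) = distr D B (\<lambda>\<omega>. \<omega>)"
    proof (rule distr_cong[OF refl refl])
      fix \<omega> assume "\<omega> \<in> space D"
      then have "\<omega> \<in> extensional {..<T}"
        by (simp add: D_def B_def space_PiM PiE_def)
      then show "(\<lambda>t\<in>{..<T}. X t \<omega>) = \<omega>" by (simp add: X_def extensional_restrict)
    qed
    also have "\<dots> = D" by (rule distr_id2[OF sD[symmetric]])
    also have "D = (\<Pi>\<^sub>M t\<in>{..<T}. distr \<Omega> borel (W t))"
      unfolding D_def B_def R_def
      using ind meas False by (subst indep_vars_iff_distr_eq_PiM'[symmetric]) auto
    also have "\<dots> = (\<Pi>\<^sub>M t\<in>{..<T}. distr D borel (X t))"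
      by (rule PiM_cong) (auto simp: law lawD)
    finally show ?thesis
      using False XD by (subst D.indep_vars_iff_distr_eq_PiM') (auto simp: B_def)
  qed
  have "err_law \<Omega> A W i = err_law D A X i" if "i \<le> T" for i
  proof -
    have "err_law D A X i = distr \<Omega> borel ((\<lambda>\<omega>. err A (\<lambda>t. X t \<omega>) i) \<circ> R)"
      unfolding err_law_def D_def
      using that X by (intro distr_distr[OF _ R] borel_measurable_err) auto
    also have "(\<lambda>\<omega>. err A (\<lambda>t. X t \<omega>) i) \<circ> R = (\<lambda>\<omega>. err A (\<lambda>t. W t \<omega>) i)"
    proof
      fix \<omega>
      have "err A (\<lambda>t. X t (R \<omega>)) i = err A (\<lambda>t. W t \<omega>) i"
        using that by (intro err_cong) (simp add: X_def R_def)
      then show "((\<lambda>\<omega>. err A (\<lambda>t. X t \<omega>) i) \<circ> R) \<omega> = err A (\<lambda>t. W t \<omega>) i"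
        by simp
    qed
    finally show ?thesis by (simp add: err_law_def)
  qed
  then have "\<forall>i\<le>T. Q i = err_law D A X i" using Q by simp
  moreover have "iid_with_law D X {..<T} P"
    using indD lawD D.prob_space_axioms by (auto simp: iid_with_law_def)
  ultimately show ?thesis
    using P unfolding ambiguity_tube_def by blast
qed

end

theory Submission
  imports Defs
begin

text \<open>
  The bound holds because one good coupling of the disturbance laws, reused independently at
  every time step, drives both error recursions at once. Let \<open>\<eta>\<close> couple the true and the empirical
  disturbance law. If \<open>(e, e')\<close> is a coupled pair of errors at time \<open>i\<close> and \<open>(w, w')\<close> is an independent
  draw from \<open>\<eta>\<close>, then \<open>(A\<^sub>i e + w, A\<^sub>i e' + w')\<close> is a coupled pair of errors at time \<open>i + 1\<close>, and
  \<open>N (A\<^sub>i (e - e') + (w - w')) \<le> \<parallel>A\<^sub>i\<parallel> N (e - e') + N (w - w')\<close>. Integrating shows that the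
  transport cost at time \<open>i\<close> is at most \<open>g\<^sub>i\<close> times that of \<open>\<eta>\<close>, where \<open>g\<^sub>0 = 0\<close> and
  \<open>g\<^sub>i\<^sub>+\<^sub>1 = \<parallel>A\<^sub>i\<parallel> g\<^sub>i + 1\<close>. The solution of this recursion is the sum of products in the theorem.

  Two facts about the laws carry this. By independence of the noise, the law of the next error
  depends only on the law of the present one and on the disturbance law (\<open>err_law_Suc\<close>), so the
  couplings need not live on the two given noise spaces, which may be unrelated. The pushforward
  of a product of two couplings under the dynamics is again a coupling of the right marginals
  (\<open>affine_push_coupling\<close>). Induction on time keeps \<open>\<eta>\<close> fixed (\<open>err_law_coupling\<close>). The infimum
  that defines the Wasserstein distance is taken only at the end (\<open>le_mult_wasserstein1\<close>), so no
  optimal coupling has to exist.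
\<close>

section \<open>Norms on a finite-dimensional space\<close>

text \<open>A norm is a finite convex function on all of a finite-dimensional space, hence continuous.
  This supplies the measurability of the transport cost and the compactness argument below.\<close>

lemma is_norm_continuous_on:
  fixes N :: "real ^ 'n \<Rightarrow> real"
  assumes "is_norm N"
  shows "continuous_on S N"
proof -
  have "convex_on UNIV N"
  proof (rule convex_onI)
    fix t :: real and x y :: "real ^ 'n"
    assume t: "0 < t" "t < 1"
    have "N ((1 - t) *\<^sub>R x + t *\<^sub>R y) \<le> N ((1 - t) *\<^sub>R x) + N (t *\<^sub>R y)"
      using assms unfolding is_norm_def by blast
    also have "\<dots> = (1 - t) * N x + t * N y"
      using assms t by (simp add: is_norm_def)
    finally show "N ((1 - t) *\<^sub>R x + t *\<^sub>R y) \<le> (1 - t) * N x + t * N y" .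
  qed simp
  then have "continuous_on UNIV N"
    by (rule convex_on_continuous[OF open_UNIV])
  then show ?thesis
    by (rule continuous_on_subset) simp
qed

text \<open>The real-valued supremum in the induced norm carries information only when its range is bounded.
  The quotient is invariant under scaling, so all its values are attained on the Euclidean unit
  sphere, which is compact.\<close>

lemma bdd_above_induced_norm:
  fixes N :: "real ^ 'n \<Rightarrow> real"
  assumes N: "is_norm N"
  shows "bdd_above ((\<lambda>x. N (B *v x) / N x) ` {x. x \<noteq> 0})"
proof -
  let ?f = "\<lambda>x. N (B *v x) / N x"
  have "continuous_on (sphere 0 1) (\<lambda>x. N (B *v x))"
    by (rule continuous_on_compose2[OF is_norm_continuous_on[OF N, of UNIV]])
       (auto intro!: linear_continuous_on simp: linear_conv_bounded_linear[symmetric])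
  moreover have "\<forall>x\<in>sphere 0 1. N x \<noteq> 0"
    using N by (auto simp: is_norm_def)
  ultimately have "continuous_on (sphere 0 1) ?f"
    using is_norm_continuous_on[OF N] by (intro continuous_on_divide) auto
  then have "bdd_above (?f ` sphere 0 1)"
    by (intro bounded_imp_bdd_above compact_imp_bounded compact_continuous_image) auto
  moreover have "?f ` {x. x \<noteq> 0} \<subseteq> ?f ` sphere 0 1"
  proof (rule image_subsetI)
    fix x :: "real ^ 'n" assume "x \<in> {x. x \<noteq> 0}"
    then have x: "x \<noteq> 0" by simp
    have "?f x = ?f (x /\<^sub>R norm x)"
      using N x by (simp add: is_norm_def matrix_vector_mult_scaleR)
    moreover have "x /\<^sub>R norm x \<in> sphere 0 1" using x by simp
    ultimately show "?f x \<in> ?f ` sphere 0 1" by (rule image_eqI)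
  qed
  ultimately show ?thesis by (rule bdd_above_mono)
qed

lemma induced_norm_bound:
  fixes N :: "real ^ 'n \<Rightarrow> real"
  assumes N: "is_norm N"
  shows "N (B *v x) \<le> induced_norm N B * N x"
proof (cases "x = 0")
  case True
  moreover have "N 0 = 0" using N by (simp add: is_norm_def)
  ultimately show ?thesis by simp
next
  case False
  then have "N (B *v x) / N x \<le> induced_norm N B"
    unfolding induced_norm_def by (intro cSUP_upper bdd_above_induced_norm[OF N]) simp
  moreover have "0 < N x" using N False by (simp add: is_norm_def less_le)
  ultimately show ?thesis by (simp add: pos_divide_le_eq)
qed

lemma induced_norm_nonneg:
  fixes N :: "real ^ 'n \<Rightarrow> real"
  assumes N: "is_norm N"
  shows "0 \<le> induced_norm N B"
proof -
  have "0 \<le> N (B *v axis undefined 1) / N (axis undefined 1)"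
    using N by (simp add: is_norm_def)
  also have "\<dots> \<le> induced_norm N B"
    unfolding induced_norm_def by (intro cSUP_upper bdd_above_induced_norm[OF N]) (simp add: axis_eq_0_iff)
  finally show ?thesis .
qed

lemma induced_norm_mat_1:
  fixes N :: "real ^ 'n \<Rightarrow> real"
  assumes N: "is_norm N"
  shows "induced_norm N (mat 1) = 1"
proof -
  have "(\<lambda>x. N (mat 1 *v x) / N x) ` {x. x \<noteq> 0} = (\<lambda>x. 1) ` {x :: real ^ 'n. x \<noteq> 0}"
    using N by (intro image_cong) (auto simp: is_norm_def)
  moreover have "axis undefined 1 \<in> {x :: real ^ 'n. x \<noteq> 0}" by (simp add: axis_eq_0_iff)
  ultimately show ?thesis
    unfolding induced_norm_def by (metis cSUP_const empty_iff)
qed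

section \<open>The amplification factor of the error recursion\<close>

text \<open>One step of the dynamics multiplies the existing discrepancy by \<open>\<parallel>A\<^sub>i\<parallel>\<close> and adds one unit of
  disturbance discrepancy.\<close>

primrec err_gain :: "(real ^ 'n \<Rightarrow> real) \<Rightarrow> (nat \<Rightarrow> real ^ 'n ^ 'n) \<Rightarrow> nat \<Rightarrow> real" where
  "err_gain N A 0 = 0"
| "err_gain N A (Suc i) = induced_norm N (A i) * err_gain N A i + 1"

lemma err_gain_nonneg: "is_norm N \<Longrightarrow> 0 \<le> err_gain N A i"
  by (induction i) (simp_all add: induced_norm_nonneg)

text \<open>Passing from \<open>i\<close> to \<open>i + 1\<close> prepends the factor \<open>\<parallel>A\<^sub>i\<parallel>\<close>, as the index \<open>j = 0\<close>, to the product
  of every old \<open>m\<close> and adds the summand \<open>m = i\<close>. The last factor of each product has exponent \<open>0\<close>,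
  so it is the norm of the identity; for \<open>m = i\<close> it is the only factor.\<close>

lemma err_gain_eq_sum_prod:
  assumes N: "is_norm N"
  shows "err_gain N A i =
    (\<Sum>m<i. \<Prod>j = 0..i - 1 - m. induced_norm N (matpow (A (i - 1 - j)) (min 1 (i - 1 - m - j))))"
proof (induction i)
  case (Suc i)
  let ?g = "\<lambda>i m j. induced_norm N (matpow (A (i - 1 - j)) (min 1 (i - 1 - m - j)))"
  have "(\<Prod>j = 0..i - m. ?g (Suc i) m j) = induced_norm N (A i) * (\<Prod>j = 0..i - 1 - m. ?g i m j)"
    if "m < i" for m
  proof -
    have "{0..i - m} = {0..Suc (i - 1 - m)}" using that by auto
    then have "(\<Prod>j = 0..i - m. ?g (Suc i) m j) =
        ?g (Suc i) m 0 * (\<Prod>j = 0..i - 1 - m. ?g (Suc i) m (Suc j))"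
      by (simp only: prod.atLeast0_atMost_Suc_shift comp_def)
    also have "?g (Suc i) m 0 = induced_norm N (A i)"
      using that by (simp add: min_def matpow_def Suc_le_eq)
    also have "(\<Prod>j = 0..i - 1 - m. ?g (Suc i) m (Suc j)) = (\<Prod>j = 0..i - 1 - m. ?g i m j)"
      by (intro prod.cong refl arg_cong2[where f = "\<lambda>a b. induced_norm N (matpow (A a) b)"]) auto
    finally show ?thesis .
  qed
  then have "(\<Sum>m<i. \<Prod>j = 0..i - m. ?g (Suc i) m j) =
      induced_norm N (A i) * (\<Sum>m<i. \<Prod>j = 0..i - 1 - m. ?g i m j)"
    by (simp add: sum_distrib_left)
  moreover have "(\<Prod>j = 0..i - i. ?g (Suc i) i j) = 1"
    using N by (simp add: matpow_def induced_norm_mat_1)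
  ultimately show ?case using Suc.IH by simp
qed simp

section \<open>The error laws as a Markov recursion\<close>

definition affine_push ::
  "real ^ 'n ^ 'n \<Rightarrow> (real ^ 'n) measure \<Rightarrow> (real ^ 'n) measure \<Rightarrow> (real ^ 'n) measure" where
  "affine_push B Q P = distr (Q \<Otimes>\<^sub>M P) borel (\<lambda>(x, w). B *v x + w)"

lemma borel_measurable_matrix_vector_mult [measurable]:
  "(\<lambda>x. (B :: real ^ 'n ^ 'm) *v x) \<in> borel_measurable borel"
  by (intro borel_measurable_continuous_onI linear_continuous_on)
     (simp add: linear_conv_bounded_linear[symmetric])

text \<open>The error at time \<open>i\<close> is a function of the noise at times below \<open>i\<close>, so it is independent of the
  noise at time \<open>i\<close>, and their joint law is the product of their laws.\<close>

lemma err_law_Suc: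
  fixes W :: "nat \<Rightarrow> 'b \<Rightarrow> real ^ 'n"
  assumes iid: "iid_with_law \<Omega> W {..<T} P" and i: "i < T"
  shows "err_law \<Omega> A W (Suc i) = affine_push (A i) (err_law \<Omega> A W i) P"
proof -
  interpret prob_space \<Omega> using iid by (simp add: iid_with_law_def)
  have ind: "indep_vars (\<lambda>_. borel) W {..<T}" and law: "distr \<Omega> borel (W i) = P"
    using iid i by (auto simp: iid_with_law_def)
  have "indep_var (\<Pi>\<^sub>M t\<in>{..<i}. borel) (\<lambda>\<omega>. \<lambda>t\<in>{..<i}. W t \<omega>) (\<Pi>\<^sub>M t\<in>{i}. borel) (\<lambda>\<omega>. \<lambda>t\<in>{i}. W t \<omega>)"
    using i by (intro indep_var_restrict[OF ind]) auto
  moreover have "(\<lambda>v. err A v i) \<in> borel_measurable (\<Pi>\<^sub>M t\<in>{..<i}. borel)"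
    by (rule borel_measurable_err[where W = "\<lambda>t v. v t"]) (simp add: measurable_component_singleton)
  moreover have "(\<lambda>v. v i) \<in> borel_measurable (\<Pi>\<^sub>M t\<in>{i}. borel)"
    by (simp add: measurable_component_singleton)
  ultimately have "indep_var borel ((\<lambda>v. err A v i) \<circ> (\<lambda>\<omega>. \<lambda>t\<in>{..<i}. W t \<omega>))
      borel ((\<lambda>v. v i) \<circ> (\<lambda>\<omega>. \<lambda>t\<in>{i}. W t \<omega>))"
    by (rule indep_var_compose)
  moreover have "(\<lambda>v. err A v i) \<circ> (\<lambda>\<omega>. \<lambda>t\<in>{..<i}. W t \<omega>) = (\<lambda>\<omega>. err A (\<lambda>t. W t \<omega>) i)"
    by (rule ext) (auto intro!: err_cong)
  moreover have "(\<lambda>v. v i) \<circ> (\<lambda>\<omega>. \<lambda>t\<in>{i}. W t \<omega>) = W i"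
    by auto
  ultimately have indep: "indep_var borel (\<lambda>\<omega>. err A (\<lambda>t. W t \<omega>) i) borel (W i)"
    by simp
  then have [measurable]: "(\<lambda>\<omega>. err A (\<lambda>t. W t \<omega>) i) \<in> borel_measurable \<Omega>" "W i \<in> borel_measurable \<Omega>"
    by (auto dest: indep_var_rv1 indep_var_rv2)
  have "affine_push (A i) (err_law \<Omega> A W i) P =
      distr (distr \<Omega> (borel \<Otimes>\<^sub>M borel) (\<lambda>\<omega>. (err A (\<lambda>t. W t \<omega>) i, W i \<omega>))) borel (\<lambda>(x, w). A i *v x + w)"
    using indep law unfolding affine_push_def err_law_def indep_var_distribution_eq by simp
  also have "\<dots> = err_law \<Omega> A W (Suc i)"
    by (subst distr_distr) (auto simp: err_law_def comp_def)
  finally show ?thesis by simp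
qed

section \<open>Transport of couplings\<close>

definition transport_cost ::
  "(real ^ 'n \<Rightarrow> real) \<Rightarrow> ((real ^ 'n) \<times> (real ^ 'n)) measure \<Rightarrow> ennreal" where
  "transport_cost N \<gamma> = (\<integral>\<^sup>+ (x, y). ennreal (N (x - y)) \<partial>\<gamma>)"

lemma wasserstein1_eq_transport_cost:
  "wasserstein1 N Q1 Q2 = (INF \<gamma>\<in>couplings Q1 Q2. transport_cost N \<gamma>)"
  by (simp add: wasserstein1_def transport_cost_def)

text \<open>A linear bound in the cost of every coupling survives passage to the infimum, which is
  approached up to an arbitrarily small slack.\<close>

lemma le_mult_wasserstein1:
  assumes W: "wasserstein1 N P P' \<le> ennreal \<epsilon>" and "0 \<le> c" and "0 \<le> \<epsilon>"
    and le: "\<And>\<eta>. \<eta> \<in> couplings P P' \<Longrightarrow> x \<le> ennreal c * transport_cost N \<eta>"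
  shows "x \<le> ennreal (c * \<epsilon>)"
proof (rule ennreal_le_epsilon)
  fix e :: real assume e: "0 < e"
  \<comment> \<open>The shift by one keeps the slack well defined for \<open>c = 0\<close>.\<close>
  define d where "d = e / (c + 1)"
  have d: "0 < d" "c * d \<le> e"
    using e \<open>0 \<le> c\<close> by (auto simp: d_def field_simps)
  have "wasserstein1 N P P' < ennreal (\<epsilon> + d)"
    using W d \<open>0 \<le> \<epsilon>\<close> by (auto intro: le_less_trans simp: ennreal_less_iff)
  then obtain \<eta> where \<eta>: "\<eta> \<in> couplings P P'" "transport_cost N \<eta> < ennreal (\<epsilon> + d)"
    unfolding wasserstein1_eq_transport_cost INF_less_iff by auto
  have "x \<le> ennreal c * ennreal (\<epsilon> + d)"
    using le[OF \<eta>(1)] \<eta>(2) by (meson less_imp_le mult_left_mono order_trans zero_le)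
  also have "\<dots> \<le> ennreal (c * \<epsilon> + e)"
    using d \<open>0 \<le> c\<close> \<open>0 \<le> \<epsilon>\<close>
    by (subst ennreal_mult[symmetric]) (auto simp: distrib_left simp del: ennreal_plus intro: ennreal_leI)
  also have "\<dots> = ennreal (c * \<epsilon>) + ennreal e"
    using e \<open>0 \<le> c\<close> \<open>0 \<le> \<epsilon>\<close> by simp
  finally show "x \<le> ennreal (c * \<epsilon>) + ennreal e" .
qed

lemma affine_push_distr:
  assumes "prob_space \<gamma>" "prob_space \<eta>"
    and f: "f \<in> borel_measurable \<gamma>" and g: "g \<in> borel_measurable \<eta>"
  shows "affine_push B (distr \<gamma> borel f) (distr \<eta> borel g) =
    distr (\<gamma> \<Otimes>\<^sub>M \<eta>) borel (\<lambda>(u, v). B *v f u + g v)"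
proof -
  interpret \<eta>: prob_space \<eta> by fact
  have "sigma_finite_measure (distr \<eta> borel g)"
    using g by (intro prob_space_imp_sigma_finite \<eta>.prob_space_distr)
  then have "distr \<gamma> borel f \<Otimes>\<^sub>M distr \<eta> borel g =
      distr (\<gamma> \<Otimes>\<^sub>M \<eta>) (borel \<Otimes>\<^sub>M borel) (\<lambda>(u, v). (f u, g v))"
    by (rule pair_measure_distr[OF f g])
  moreover have "distr \<dots> borel (\<lambda>(x, w). B *v x + w) = distr (\<gamma> \<Otimes>\<^sub>M \<eta>) borel (\<lambda>(u, v). B *v f u + g v)"
    using f g by (subst distr_distr) (auto simp: comp_def case_prod_beta')
  ultimately show ?thesis by (simp add: affine_push_def)
qed

text \<open>Drawing the state pair and the disturbance pair independently and applying the dynamics to each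
  side couples the next laws. The triangle inequality bounds the cost pointwise, and since both
  couplings have total mass one, each term integrates to its own cost.\<close>

lemma affine_push_coupling:
  fixes N :: "real ^ 'n \<Rightarrow> real"
  assumes N: "is_norm N" and \<gamma>: "\<gamma> \<in> couplings Q Q'" and \<eta>: "\<eta> \<in> couplings P P'"
  obtains \<kappa> where "\<kappa> \<in> couplings (affine_push B Q P) (affine_push B Q' P')"
    and "transport_cost N \<kappa> \<le> ennreal (induced_norm N B) * transport_cost N \<gamma> + transport_cost N \<eta>"
proof -
  interpret \<gamma>: prob_space \<gamma> using \<gamma> by (simp add: couplings_def)
  interpret \<eta>: prob_space \<eta> using \<eta> by (simp add: couplings_def)
  interpret prod: pair_prob_space \<gamma> \<eta> ..
  have sets[measurable_cong]: "sets \<gamma> = sets (borel \<Otimes>\<^sub>M borel)" "sets \<eta> = sets (borel \<Otimes>\<^sub>M borel)"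
    using \<gamma> \<eta> by (auto simp: couplings_def)
  have marg: "distr \<gamma> borel fst = Q" "distr \<gamma> borel snd = Q'"
      "distr \<eta> borel fst = P" "distr \<eta> borel snd = P'"
    using \<gamma> \<eta> by (auto simp: couplings_def)
  have [measurable]: "N \<in> borel_measurable borel"
    by (rule borel_measurable_continuous_onI[OF is_norm_continuous_on[OF N]])
  define F where "F = (\<lambda>(u, v). (B *v fst u + fst v, B *v snd u + (snd v :: real ^ 'n)))"
  have F[measurable]: "F \<in> measurable (\<gamma> \<Otimes>\<^sub>M \<eta>) (borel \<Otimes>\<^sub>M borel)"
    unfolding F_def by measurable
  define \<kappa> where "\<kappa> = distr (\<gamma> \<Otimes>\<^sub>M \<eta>) (borel \<Otimes>\<^sub>M borel) F"
  show thesis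
  proof
    have "distr \<kappa> borel fst = affine_push B Q P"
      unfolding \<kappa>_def marg(1,3)[symmetric]
      by (subst distr_distr, simp, simp, subst affine_push_distr)
         (auto simp: \<gamma>.prob_space_axioms \<eta>.prob_space_axioms F_def comp_def case_prod_beta')
    moreover have "distr \<kappa> borel snd = affine_push B Q' P'"
      unfolding \<kappa>_def marg(2,4)[symmetric]
      by (subst distr_distr, simp, simp, subst affine_push_distr)
         (auto simp: \<gamma>.prob_space_axioms \<eta>.prob_space_axioms F_def comp_def case_prod_beta')
    ultimately show "\<kappa> \<in> couplings (affine_push B Q P) (affine_push B Q' P')"
      by (simp add: couplings_def \<kappa>_def prod.prob_space_distr)
    let ?c = "\<lambda>u. ennreal (N (fst u - snd u))"
    have cost: "transport_cost N \<gamma> = (\<integral>\<^sup>+ u. ?c u \<partial>\<gamma>)" "transport_cost N \<eta> = (\<integral>\<^sup>+ v. ?c v \<partial>\<eta>)"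
      by (simp_all add: transport_cost_def case_prod_beta')
    have pointwise: "?c (F (u, v)) \<le> ennreal (induced_norm N B) * ?c u + ?c v" for u v
    proof -
      have "fst (F (u, v)) - snd (F (u, v)) = B *v (fst u - snd u) + (fst v - snd v)"
        by (simp add: F_def matrix_vector_mult_diff_distrib)
      then have "N (fst (F (u, v)) - snd (F (u, v))) \<le> N (B *v (fst u - snd u)) + N (fst v - snd v)"
        using N by (simp add: is_norm_def)
      also have "\<dots> \<le> induced_norm N B * N (fst u - snd u) + N (fst v - snd v)"
        using induced_norm_bound[OF N] by simp
      finally show ?thesis
        using N induced_norm_nonneg[OF N]
        by (simp add: is_norm_def ennreal_mult[symmetric] ennreal_plus[symmetric] del: ennreal_plus)
    qed
    have "transport_cost N \<kappa> = (\<integral>\<^sup>+ z. ?c (F z) \<partial>(\<gamma> \<Otimes>\<^sub>M \<eta>))"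
      unfolding transport_cost_def \<kappa>_def by (subst nn_integral_distr) (auto simp: case_prod_beta)
    also have "\<dots> = (\<integral>\<^sup>+ u. \<integral>\<^sup>+ v. ?c (F (u, v)) \<partial>\<eta> \<partial>\<gamma>)"
      by (rule \<eta>.nn_integral_fst[symmetric]) measurable
    also have "\<dots> \<le> (\<integral>\<^sup>+ u. \<integral>\<^sup>+ v. ennreal (induced_norm N B) * ?c u + ?c v \<partial>\<eta> \<partial>\<gamma>)"
      by (intro nn_integral_mono pointwise)
    also have "\<dots> = ennreal (induced_norm N B) * transport_cost N \<gamma> + transport_cost N \<eta>"
      by (simp add: cost nn_integral_add nn_integral_cmult \<gamma>.emeasure_space_1 \<eta>.emeasure_space_1)
    finally show "transport_cost N \<kappa> \<le>
      ennreal (induced_norm N B) * transport_cost N \<gamma> + transport_cost N \<eta>" .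
  qed
qed

text \<open>Both recursions start at \<open>0\<close>, so the point mass at the origin couples them at no cost. The same
  \<open>\<eta>\<close> serves at each later step, which is possible because the noise is identically distributed.\<close>

lemma err_law_coupling:
  fixes N :: "real ^ 'n \<Rightarrow> real"
  assumes N: "is_norm N"
    and W: "iid_with_law \<Omega> W {..<T} P" and W': "iid_with_law \<Omega>' W' {..<T} P'"
    and \<eta>: "\<eta> \<in> couplings P P'" and i: "i \<le> T"
  shows "\<exists>\<gamma>\<in>couplings (err_law \<Omega> A W i) (err_law \<Omega>' A W' i).
    transport_cost N \<gamma> \<le> ennreal (err_gain N A i) * transport_cost N \<eta>"
  using i
proof (induction i)
  case 0
  interpret \<Omega>: prob_space \<Omega> using W by (simp add: iid_with_law_def)
  interpret \<Omega>': prob_space \<Omega>' using W' by (simp add: iid_with_law_def)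
  let ?\<gamma> = "return (borel \<Otimes>\<^sub>M borel) (0 :: real ^ 'n, 0 :: real ^ 'n)"
  have "err_law \<Omega> A W 0 = return borel 0" "err_law \<Omega>' A W' 0 = return borel 0"
    by (simp_all add: err_law_def \<Omega>.distr_const \<Omega>'.distr_const)
  then have "?\<gamma> \<in> couplings (err_law \<Omega> A W 0) (err_law \<Omega>' A W' 0)"
    by (auto simp: couplings_def distr_return space_pair_measure intro!: prob_space_return)
  moreover have "transport_cost N ?\<gamma> = 0"
  proof -
    have [measurable]: "N \<in> borel_measurable borel"
      by (rule borel_measurable_continuous_onI[OF is_norm_continuous_on[OF N]])
    have "N 0 = 0" using N by (simp add: is_norm_def)
    then show ?thesis
      unfolding transport_cost_def by (subst nn_integral_return) (auto simp: space_pair_measure)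
  qed
  ultimately show ?case by (intro bexI[of _ ?\<gamma>]) simp_all
next
  case (Suc i)
  then obtain \<gamma> where \<gamma>: "\<gamma> \<in> couplings (err_law \<Omega> A W i) (err_law \<Omega>' A W' i)"
    and le: "transport_cost N \<gamma> \<le> ennreal (err_gain N A i) * transport_cost N \<eta>"
    by auto
  obtain \<kappa> where \<kappa>: "\<kappa> \<in> couplings (err_law \<Omega> A W (Suc i)) (err_law \<Omega>' A W' (Suc i))"
    and "transport_cost N \<kappa> \<le> ennreal (induced_norm N (A i)) * transport_cost N \<gamma> + transport_cost N \<eta>"
    using affine_push_coupling[OF N \<gamma> \<eta>, of "A i"] err_law_Suc[OF W, of i A] err_law_Suc[OF W', of i A] Suc.prems
    by (metis Suc_le_lessD)
  note this(2)
  also have "\<dots> \<le> ennreal (induced_norm N (A i)) * (ennreal (err_gain N A i) * transport_cost N \<eta>)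
      + transport_cost N \<eta>"
    using le by (intro add_right_mono mult_left_mono) auto
  also have "\<dots> = ennreal (err_gain N A (Suc i)) * transport_cost N \<eta>"
    using N by (simp add: induced_norm_nonneg err_gain_nonneg ennreal_mult distrib_right mult.assoc)
  finally show ?case using \<kappa> by blast
qed

section \<open>The radius of the Wasserstein tube\<close>

theorem proposition2:
  fixes N :: "real ^ 'n \<Rightarrow> real"
    and H :: "real ^ 'n ^ 'm" and h :: "real ^ 'm"
    and M T :: nat
    and wh :: "nat \<Rightarrow> real ^ 'n"
    and A :: "nat \<Rightarrow> real ^ 'n ^ 'n"
    and \<epsilon> :: real
    and \<Omega>hat :: "'b measure" and What :: "nat \<Rightarrow> 'b \<Rightarrow> real ^ 'n"
    and Q :: "nat \<Rightarrow> (real ^ 'n) measure"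
  assumes "is_norm N"
    and "1 \<le> M"
    and "\<forall>l\<in>{1..M}. wh l \<in> disturbance_support H h"
    and "0 < \<epsilon>"
    and "iid_with_law \<Omega>hat What {..<T} (empirical M wh)"
    and "Q \<in> ambiguity_tube N (disturbance_support H h) T A (empirical M wh) \<epsilon>"
  shows "\<forall>i\<le>T. wasserstein1 N (Q i) (err_law \<Omega>hat A What i) \<le>
    ennreal (\<epsilon> * (\<Sum>m<i. \<Prod>j = 0..i - 1 - m.
      induced_norm N (matpow (A (i - 1 - j)) (min 1 (i - 1 - m - j)))))"
proof (intro allI impI)
  fix i assume i: "i \<le> T"
  obtain P \<Omega> W where P: "wasserstein1 N P (empirical M wh) \<le> ennreal \<epsilon>"
    and iid: "iid_with_law (\<Omega> :: (nat \<Rightarrow> real ^ 'n) measure) W {..<T} P"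
    and Q: "\<forall>i\<le>T. Q i = err_law \<Omega> A W i"
    using assms(6) by (auto simp: ambiguity_tube_def)
  have "wasserstein1 N (Q i) (err_law \<Omega>hat A What i) \<le> ennreal (err_gain N A i) * transport_cost N \<eta>"
    if \<eta>: "\<eta> \<in> couplings P (empirical M wh)" for \<eta>
  proof -
    obtain \<gamma> where "\<gamma> \<in> couplings (Q i) (err_law \<Omega>hat A What i)"
      and "transport_cost N \<gamma> \<le> ennreal (err_gain N A i) * transport_cost N \<eta>"
      using err_law_coupling[OF assms(1) iid assms(5) \<eta> i] Q i by auto
    then show ?thesis
      unfolding wasserstein1_eq_transport_cost by (blast intro: INF_lower2)
  qed
  with P have "wasserstein1 N (Q i) (err_law \<Omega>hat A What i) \<le> ennreal (err_gain N A i * \<epsilon>)"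
    using assms(1,4) by (intro le_mult_wasserstein1 err_gain_nonneg) auto
  then show "wasserstein1 N (Q i) (err_law \<Omega>hat A What i) \<le>
    ennreal (\<epsilon> * (\<Sum>m<i. \<Prod>j = 0..i - 1 - m.
      induced_norm N (matpow (A (i - 1 - j)) (min 1 (i - 1 - m - j)))))"
    using err_gain_eq_sum_prod[OF assms(1), of A i] by (simp only: mult.commute)
qed

end
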